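(* Let $D$ be a multipartite tournament having exactly two partite sets that are not $\{1,2\}$-competing. Then the following are equivalent: (i) $C_{1,2}(D)$ is an interval graph; (ii) $C_{1,2}(D)$ is chordal; (iii) $C_{1,2}(D)$ has no induced cycle of length four. In particular, if all partite sets of $D$ except possibly one have at most three vertices, then $C_{1,2}(D)$ is an interval graph.
   Context: All graphs and digraphs are finite and simple. For a digraph $D$, $d_D(x,y)$ is the length of a shortest directed path from $x$ to $y$. The $(1,2)$-step competition graph $C_{1,2}(D)$ is the graph on $V(D)$ in which distinct $u,v$ are adjacent iff there is a vertex $w\notin\{u,v\}$ with either $d_{D-v}(u,w)\le 1$ and $d_{D-u}(v,w)\le 2$, or $d_{D-u}(v,w)\le 1$ and $d_{D-v}(u,w)\le 2$. A multipartite tournament is an orientation of a complete $k$-partite graph for some $k\ge3$ (with nonempty partite sets). A set of vertices is $\{1,2\}$-competing if it is a clique in $C_{1,2}(D)$. A graph is an interval graph if its vertices can be assigned real intervals so that two distinct vertices are adjacent iff their intervals intersect; it is chordal if it has no induced cycle of length at least four. *)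

theory Defs
  imports
    "HOL-Analysis.Analysis"
    "HOL-Library.Disjoint_Sets"
    "HOL-Library.Extended_Nat"
    "Graph_Theory.Graph_Theory"
begin

text \<open>Digraphs are finite, without loops or parallel arcs (locale \<^locale>\<open>digraph\<close>). Undirected
  simple graphs are represented by symmetric arc sets (locale \<^locale>\<open>pair_graph\<close>).\<close>

text \<open>The infimum over the empty set is \<open>\<infinity>\<close>, so the distance is infinite if there is no path.\<close>

definition ddist :: "('a, 'b) pre_digraph \<Rightarrow> 'a \<Rightarrow> 'a \<Rightarrow> enat" where
  "ddist D x y = (INF p \<in> {p. pre_digraph.apath D x p y}. enat (length p))"

definition step_competes :: "('a, 'b) pre_digraph \<Rightarrow> 'a \<Rightarrow> 'a \<Rightarrow> bool" where
  "step_competes D u v \<longleftrightarrow>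
     (\<exists>w \<in> verts D. w \<notin> {u, v} \<and>
        (ddist (pre_digraph.del_vert D v) u w \<le> 1 \<and> ddist (pre_digraph.del_vert D u) v w \<le> 2 \<or>
         ddist (pre_digraph.del_vert D u) v w \<le> 1 \<and> ddist (pre_digraph.del_vert D v) u w \<le> 2))"

definition step_competition_graph :: "('a, 'b) pre_digraph \<Rightarrow> 'a pair_pre_digraph" where
  "step_competition_graph D =
     \<lparr> pverts = verts D,
       parcs = {(u, v). u \<in> verts D \<and> v \<in> verts D \<and> u \<noteq> v \<and> step_competes D u v} \<rparr>"

lemma step_competes_sym: "step_competes D u v \<longleftrightarrow> step_competes D v u"
  unfolding step_competes_def by auto

lemma pair_graph_step_competition_graph:
  assumes "digraph D"
  shows "pair_graph (step_competition_graph D)"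
proof -
  interpret digraph D by fact
  have "parcs (step_competition_graph D) \<subseteq> verts D \<times> verts D"
    by (auto simp: step_competition_graph_def)
  then have "finite (parcs (step_competition_graph D))"
    by (rule finite_subset) simp
  then show ?thesis
    by unfold_locales
      (auto simp: step_competition_graph_def arcs_ends_def arc_to_ends_def symmetric_def sym_def
         intro: step_competes_sym[THEN iffD1])
qed

text \<open>\<open>P\<close> is the set of partite sets; \<^const>\<open>partition_on\<close> makes them nonempty and pairwise disjoint.
  The last conjunct says that \<open>D\<close> is an orientation of the complete multipartite graph with partite
  sets \<open>P\<close>.\<close>

definition multipartite_tournament :: "('a, 'b) pre_digraph \<Rightarrow> 'a set set \<Rightarrow> bool" where
  "multipartite_tournament D P \<longleftrightarrow>
     digraph D \<and> partition_on (verts D) P \<and> card P \<ge> 3 \<and>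
     (\<forall>X \<in> P. \<forall>Y \<in> P. \<forall>u \<in> X. \<forall>v \<in> Y.
        if X = Y then (u, v) \<notin> arcs_ends D
        else ((u, v) \<in> arcs_ends D) \<noteq> ((v, u) \<in> arcs_ends D))"

definition is_clique :: "'a pair_pre_digraph \<Rightarrow> 'a set \<Rightarrow> bool" where
  "is_clique G X \<longleftrightarrow> X \<subseteq> pverts G \<and> (\<forall>u \<in> X. \<forall>v \<in> X. u \<noteq> v \<longrightarrow> (u, v) \<in> parcs G)"

definition step_competing :: "('a, 'b) pre_digraph \<Rightarrow> 'a set \<Rightarrow> bool" where
  "step_competing D X \<longleftrightarrow> is_clique (step_competition_graph D) X"

definition interval_graph :: "'a pair_pre_digraph \<Rightarrow> bool" where
  "interval_graph G \<longleftrightarrow>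
     (\<exists>I :: 'a \<Rightarrow> real set.
        (\<forall>v \<in> pverts G. is_interval (I v) \<and> I v \<noteq> {}) \<and>
        (\<forall>u \<in> pverts G. \<forall>v \<in> pverts G. u \<noteq> v \<longrightarrow> ((u, v) \<in> parcs G \<longleftrightarrow> I u \<inter> I v \<noteq> {})))"

text \<open>An induced cycle is given by the cyclic sequence of its vertices; this is meaningful for
  length at least three.\<close>

definition induced_cycle :: "'a pair_pre_digraph \<Rightarrow> 'a list \<Rightarrow> bool" where
  "induced_cycle G vs \<longleftrightarrow>
     length vs \<ge> 3 \<and> distinct vs \<and> set vs \<subseteq> pverts G \<and>
     (\<forall>i < length vs. \<forall>j < length vs.
        (vs ! i, vs ! j) \<in> parcs G \<longleftrightarrow> j = Suc i mod length vs \<or> i = Suc j mod length vs)"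

definition chordal :: "'a pair_pre_digraph \<Rightarrow> bool" where
  "chordal G \<longleftrightarrow> \<not> (\<exists>vs. induced_cycle G vs \<and> length vs \<ge> 4)"

end

theory Submission
  imports Defs
begin

text \<open>
  Write \<open>N u\<close> for the out-neighbourhood of \<open>u\<close>, and let \<open>X\<close> and \<open>Y\<close> be the two partite sets that
  are not competing. There are no sinks, every vertex outside \<open>X \<union> Y\<close> competes with all others, two
  vertices of \<open>X\<close> fail to compete iff their out-neighbourhoods are disjoint subsets of \<open>Y\<close> (and
  symmetrically), and \<open>x \<in> X\<close>, \<open>y \<in> Y\<close> fail to compete iff \<open>N x = {y}\<close> or \<open>N y = {x}\<close>.
  An induced four-cycle of the competition graph is an induced \<open>2K\<^sub>2\<close> of its complement. If there is
  none, then a non-edge inside \<open>X\<close> is linked to a non-edge inside \<open>Y\<close>, say by \<open>N y\<^sub>1 = {x\<^sub>2}\<close>.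
  Then all non-edges inside \<open>X\<close> contain \<open>x\<^sub>2\<close>, and every non-edge inside \<open>Y\<close> has exactly one end
  dominating \<open>x\<^sub>2\<close>, so that orienting the complement along a ranking of the four classes it lives on
  is transitive. A partial order without \<open>2 + 2\<close> is an interval order.
  If \<open>X\<close> has at most three vertices, every non-edge inside \<open>Y\<close> has an end with exactly one
  out-neighbour, and this excludes an induced \<open>2K\<^sub>2\<close>.
\<close>

section \<open>Interval graphs\<close>

lemma interval_graph_imp_chordal:
  assumes "interval_graph G"
  shows "chordal G"
  unfolding chordal_def
proof
  assume "\<exists>vs. induced_cycle G vs \<and> length vs \<ge> 4"
  then obtain vs where cyc: "induced_cycle G vs" and len: "length vs \<ge> 4"
    by blast
  obtain I :: "'a \<Rightarrow> real set" where int: "\<forall>v \<in> pverts G. is_interval (I v) \<and> I v \<noteq> {}"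
    and adj: "\<forall>u \<in> pverts G. \<forall>v \<in> pverts G. u \<noteq> v \<longrightarrow>
      ((u, v) \<in> parcs G \<longleftrightarrow> I u \<inter> I v \<noteq> {})"
    using assms unfolding interval_graph_def by (elim exE conjE)
  define n where "n = length vs"
  define J where "J i = I (vs ! i)" for i
  have n: "n \<ge> 4"
    using len n_def by simp
  have mem: "vs ! i \<in> pverts G" if "i < n" for i
    using cyc that unfolding induced_cycle_def n_def by auto
  have meet: "J i \<inter> J j \<noteq> {} \<longleftrightarrow> j = Suc i mod n \<or> i = Suc j mod n"
    if "i < n" "j < n" "i \<noteq> j" for i j
  proof -
    have "vs ! i \<noteq> vs ! j"
      using cyc that unfolding induced_cycle_def n_def by (auto simp: nth_eq_iff_index_eq)
    then have "J i \<inter> J j \<noteq> {} \<longleftrightarrow> (vs ! i, vs ! j) \<in> parcs G"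
      using adj mem that unfolding J_def by blast
    then show ?thesis
      using cyc that unfolding induced_cycle_def n_def by blast
  qed
  have "\<exists>p. p \<in> J i \<inter> J (Suc i mod n)" if "i < n" for i
    using meet[of i "Suc i mod n"] that n by (auto simp: mod_Suc split: if_splits)
  then obtain p where p: "\<And>i. i < n \<Longrightarrow> p i \<in> J i \<inter> J (Suc i mod n)"
    by metis
  \<comment> \<open>At the leftmost of the chosen common points \<open>p i\<close> of consecutive intervals, one of the two
    intervals through it reaches past the next chosen point of the other, which yields a chord.\<close>
  obtain i where i: "i < n" and min: "\<And>j. j < n \<Longrightarrow> p i \<le> p j"
  proof -
    have "Min (p ` {..<n}) \<in> p ` {..<n}"
      using n by (intro Min_in) (auto simp: lessThan_empty_iff)
    then obtain i where "i < n" "Min (p ` {..<n}) = p i"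
      by auto
    moreover have "Min (p ` {..<n}) \<le> p j" if "j < n" for j
      using that by simp
    ultimately show thesis using that by metis
  qed
  define a where "a = (if i = 0 then n - 1 else i - 1)"
  define b where "b = Suc i mod n"
  define c where "c = Suc b mod n"
  have lt: "a < n" "b < n" "c < n"
    using i n by (auto simp: a_def b_def c_def)
  have suc: "Suc a mod n = i"
    using i n by (auto simp: a_def)
  have nab: "a \<noteq> b" "b \<noteq> Suc a mod n" "a \<noteq> Suc b mod n"
    using i n by (auto simp: a_def b_def mod_Suc split: if_splits)
  have nic: "i \<noteq> c" "c \<noteq> Suc i mod n" "i \<noteq> Suc c mod n"
    using i n by (auto simp: c_def b_def mod_Suc split: if_splits)
  have disj: "J a \<inter> J b = {}" "J i \<inter> J c = {}"
    using meet lt nab nic i by blast+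
  have pa: "p a \<in> J a" "p a \<in> J i" and pi: "p i \<in> J i" "p i \<in> J b"
    and pb: "p b \<in> J b" "p b \<in> J c"
    using p[OF lt(1)] p[OF i] p[OF lt(2)] suc by (auto simp: b_def c_def)
  have ivl: "is_interval (J i)" "is_interval (J b)"
    using int mem[OF i] mem[OF lt(2)] by (simp_all add: J_def)
  have conv: "x \<in> J i" if "p i \<le> x" "x \<le> p a" for x
    by (rule mem_is_interval_1_I[OF ivl(1) pi(1) pa(2) that])
  have conv': "x \<in> J b" if "p i \<le> x" "x \<le> p b" for x
    by (rule mem_is_interval_1_I[OF ivl(2) pi(2) pb(1) that])
  \<comment> \<open>The smaller of \<open>p a\<close> and \<open>p b\<close> lies in both
    \<open>J i\<close> and \<open>J b\<close>, hence is common to \<open>J a\<close> and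
    \<open>J b\<close> or to \<open>J i\<close> and \<open>J c\<close>.\<close>
  show False
  proof (cases "p a \<le> p b")
    case True
    then show False using conv'[of "p a"] min[OF lt(1)] pa disj by blast
  next
    case False
    then show False using conv[of "p b"] min[OF lt(2)] pb disj by auto
  qed
qed

text \<open>In a strict order without \<open>2 + 2\<close> the predecessor sets form a chain, so
  their sizes can serve as left ends; each interval extends until just before its first successor
  begins. This is the usual representation of an interval order.\<close>

lemma interval_graph_if_transitive_orientation:
  fixes G :: "'a pair_pre_digraph" and R :: "'a \<Rightarrow> 'a \<Rightarrow> bool"
  assumes fin: "finite (pverts G)"
    and irrefl: "\<And>u. \<not> R u u"
    and trans: "\<And>u v w. R u v \<Longrightarrow> R v w \<Longrightarrow> R u w"
    and nonadj: "\<And>u v. u \<in> pverts G \<Longrightarrow> v \<in> pverts G \<Longrightarrow> u \<noteq> v \<Longrightarrow>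
      (u, v) \<notin> parcs G \<longleftrightarrow> R u v \<or> R v u"
    and no22: "\<And>a b c d. {a, b, c, d} \<subseteq> pverts G \<Longrightarrow> R a b \<Longrightarrow> R c d \<Longrightarrow> R a d \<or> R c b"
  shows "interval_graph G"
proof -
  define pre where "pre v = {u \<in> pverts G. R u v}" for v
  define suc where "suc v = {w \<in> pverts G. R v w}" for v
  define l where "l v = real (card (pre v))" for v
  \<comment> \<open>Left ends are integers, so subtracting \<open>1 / 2\<close> stays below every
    successor without cutting off an earlier left end. Without successors, the number of vertices
    bounds all left ends.\<close>
  define r where "r v = (if suc v = {} then real (card (pverts G)) else Min (l ` suc v) - 1 / 2)" for v
  have fin_pre: "finite (pre v)" and fin_suc: "finite (suc v)" for v
    using fin by (auto simp: pre_def suc_def)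
  have chain: "pre v \<subseteq> pre w \<or> pre w \<subseteq> pre v" if "v \<in> pverts G" "w \<in> pverts G" for v w
  proof (rule ccontr)
    assume "\<not> ?thesis"
    then obtain a c where "a \<in> pre v" "a \<notin> pre w" "c \<in> pre w" "c \<notin> pre v"
      by blast
    then show False
      using no22[of a v c w] that by (auto simp: pre_def)
  qed
  have less: "r u < l v" if "u \<in> pverts G" "v \<in> pverts G" "R u v" for u v
  proof -
    have "v \<in> suc u"
      using that by (simp add: suc_def)
    then have "Min (l ` suc u) \<le> l v" "suc u \<noteq> {}"
      using fin_suc by auto
    then show ?thesis
      by (simp add: r_def)
  qed
  have le: "l v \<le> r u" if uv: "u \<in> pverts G" "v \<in> pverts G" "\<not> R u v" for u v
  proof (cases "suc u = {}")
    case True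
    then show ?thesis
      using fin by (auto simp: r_def l_def pre_def intro: card_mono)
  next
    case False
    have "Min (l ` suc u) \<in> l ` suc u"
      using False fin_suc by simp
    then obtain w where w: "w \<in> suc u" "Min (l ` suc u) = l w"
      by auto
    then have "u \<in> pre w" "u \<notin> pre v" "w \<in> pverts G"
      using uv by (auto simp: suc_def pre_def)
    then have "pre v \<subset> pre w"
      using chain[of v w] uv by auto
    then have "card (pre v) < card (pre w)"
      using fin_pre by (simp add: psubset_card_mono)
    then show ?thesis
      using False w by (simp add: r_def l_def)
  qed
  have "is_interval {l v..r v} \<and> {l v..r v} \<noteq> {}" if "v \<in> pverts G" for v
    using le[OF that that irrefl] by (auto simp: is_interval_cc)
  moreover have "(u, v) \<in> parcs G \<longleftrightarrow> {l u..r u} \<inter> {l v..r v} \<noteq> {}"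
    if uv: "u \<in> pverts G" "v \<in> pverts G" "u \<noteq> v" for u v
  proof -
    have "{l u..r u} \<inter> {l v..r v} \<noteq> {} \<longleftrightarrow> l u \<le> r v \<and> l v \<le> r u"
      using le[OF uv(1,1) irrefl] le[OF uv(2,2) irrefl] by (auto simp: Int_atLeastAtMost)
    also have "\<dots> \<longleftrightarrow> \<not> R u v \<and> \<not> R v u"
      using less le uv by (meson not_le)
    finally show ?thesis
      using nonadj[OF uv] by blast
  qed
  ultimately show ?thesis
    unfolding interval_graph_def by (intro exI[of _ "\<lambda>v. {l v..r v}"]) blast
qed

section \<open>Competition in terms of out-neighbourhoods\<close>

text \<open>A nonempty set of extended naturals attains its infimum, and the empty set has infimum
  infinity, so a finite bound comes from an actual path.\<close>

lemma ddist_le_iff: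
  "ddist D x y \<le> enat n \<longleftrightarrow> (\<exists>p. pre_digraph.apath D x p y \<and> length p \<le> n)"
proof
  let ?S = "(\<lambda>p. enat (length p)) ` {p. pre_digraph.apath D x p y}"
  assume le: "ddist D x y \<le> enat n"
  have "?S \<noteq> {}"
  proof
    assume "?S = {}"
    then have "ddist D x y = top"
      unfolding ddist_def by (simp only: Inf_empty)
    then show False
      using le by (simp add: top_enat_def)
  qed
  then have "ddist D x y \<in> ?S"
    unfolding ddist_def by (metis ex_in_conv wellorder_InfI)
  then show "\<exists>p. pre_digraph.apath D x p y \<and> length p \<le> n"
    using le by auto
next
  assume "\<exists>p. pre_digraph.apath D x p y \<and> length p \<le> n"
  then show "ddist D x y \<le> enat n"
    unfolding ddist_def by (auto intro: INF_lower2)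
qed

lemma (in digraph) ddist_le_1_iff:
  assumes "x \<noteq> y"
  shows "ddist G x y \<le> 1 \<longleftrightarrow> (x, y) \<in> arcs_ends G"
proof -
  have "ddist G x y \<le> 1 \<longleftrightarrow> (\<exists>p. apath x p y \<and> length p \<le> 1)"
    using ddist_le_iff[of G x y 1] by (simp add: one_enat_def)
  also have "\<dots> \<longleftrightarrow> (\<exists>e. apath x [e] y)"
    using assms by (auto simp: le_Suc_eq length_Suc_conv apath_def awalk_Nil_iff)
  also have "\<dots> \<longleftrightarrow> (x, y) \<in> arcs_ends G"
    using assms by (auto simp: apath_def awalk_Cons_iff awalk_Nil_iff arcs_ends_def arc_to_ends_def)
  finally show ?thesis .
qed

lemma (in digraph) ddist_le_2_iff:
  assumes "x \<noteq> y"
  shows "ddist G x y \<le> 2 \<longleftrightarrow> (x, y) \<in> arcs_ends G \<or> (\<exists>z. (x, z) \<in> arcs_ends G \<and> (z, y) \<in> arcs_ends G)"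
proof -
  have len: "length p \<le> 2 \<longleftrightarrow> p = [] \<or> (\<exists>e. p = [e]) \<or> (\<exists>e f. p = [e, f])" for p :: "'b list"
    by (auto simp: le_Suc_eq length_Suc_conv numeral_2_eq_2)
  have nil: "\<not> apath x [] y"
    using assms by (simp add: apath_def awalk_Nil_iff)
  have "ddist G x y \<le> 2 \<longleftrightarrow> (\<exists>p. apath x p y \<and> length p \<le> 2)"
    using ddist_le_iff[of G x y 2] by (simp add: numeral_eq_enat)
  also have "\<dots> \<longleftrightarrow> (\<exists>e. apath x [e] y) \<or> (\<exists>e f. apath x [e, f] y)"
    using nil unfolding len by metis
  also have "(\<exists>e. apath x [e] y) \<longleftrightarrow> (x, y) \<in> arcs_ends G"
    using assms by (auto simp: apath_def awalk_Cons_iff awalk_Nil_iff arcs_ends_def arc_to_ends_def)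
  also have "(\<exists>e f. apath x [e, f] y) \<longleftrightarrow> (\<exists>z. (x, z) \<in> arcs_ends G \<and> (z, y) \<in> arcs_ends G)"
    using assms no_loops
    by (fastforce simp: apath_def awalk_Cons_iff awalk_Nil_iff arcs_ends_def arc_to_ends_def)
  finally show ?thesis .
qed

definition out_nbhd :: "('a, 'b) pre_digraph \<Rightarrow> 'a \<Rightarrow> 'a set" where
  "out_nbhd D u = {w. (u, w) \<in> arcs_ends D}"

text \<open>For distinct vertices this is the negation of competition: a witness is a common
  out-neighbour, or an out-neighbour of one vertex reached by the other in two steps. Removing
  \<open>v\<close> from \<open>N u\<close> and \<open>u\<close> from \<open>N v\<close> reflects the
  vertex deletions.\<close>

definition noncompeting :: "('a \<Rightarrow> 'a set) \<Rightarrow> 'a \<Rightarrow> 'a \<Rightarrow> bool" where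
  "noncompeting N u v \<longleftrightarrow>
     u \<noteq> v \<and> (\<forall>a \<in> N u - {v}. \<forall>b \<in> N v - {u}. a \<noteq> b \<and> a \<notin> N b \<and> b \<notin> N a)"

lemma noncompeting_irrefl: "\<not> noncompeting N u u"
  unfolding noncompeting_def by blast

lemma noncompeting_sym: "noncompeting N u v \<longleftrightarrow> noncompeting N v u"
  unfolding noncompeting_def by blast

lemma (in digraph) arcs_ends_del_vert:
  "arcs_ends (del_vert v) = {(x, y) \<in> arcs_ends G. x \<noteq> v \<and> y \<noteq> v}"
  by (auto simp: arcs_ends_def arc_to_ends_def del_vert_simps)

lemma (in digraph) digraph_del_vert: "digraph (del_vert v)"
proof -
  interpret del: fin_digraph "del_vert v" by (rule fin_digraph_del_vert)
  show ?thesis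
    using no_loops no_multi_arcs
    by unfold_locales (auto simp: del_vert_simps arc_to_ends_def)
qed

lemma (in digraph) step_competes_iff:
  assumes "u \<noteq> v"
  shows "step_competes G u v \<longleftrightarrow> \<not> noncompeting (out_nbhd G) u v"
proof -
  interpret U: digraph "del_vert u" by (rule digraph_del_vert)
  interpret V: digraph "del_vert v" by (rule digraph_del_vert)
  have irr: "(x, x) \<notin> arcs_ends G" for x
    using no_loops by (auto simp: arcs_ends_def arc_to_ends_def)
  have vts: "y \<in> verts G" if "(x, y) \<in> arcs_ends G" for x y
    using that by (auto simp: arcs_ends_def arc_to_ends_def)
  let ?N = "out_nbhd G"
  have le: "ddist (del_vert v) u w \<le> 1 \<longleftrightarrow> w \<in> ?N u"
    "ddist (del_vert u) v w \<le> 1 \<longleftrightarrow> w \<in> ?N v"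
    "ddist (del_vert v) u w \<le> 2 \<longleftrightarrow> w \<in> ?N u \<or> (\<exists>z \<in> ?N u - {v}. w \<in> ?N z)"
    "ddist (del_vert u) v w \<le> 2 \<longleftrightarrow> w \<in> ?N v \<or> (\<exists>z \<in> ?N v - {u}. w \<in> ?N z)"
    if "w \<noteq> u" "w \<noteq> v" for w
    using that assms U.ddist_le_1_iff[of v w] V.ddist_le_1_iff[of u w]
      U.ddist_le_2_iff[of v w] V.ddist_le_2_iff[of u w]
    by (auto simp: arcs_ends_del_vert out_nbhd_def)
  have N: "x \<notin> ?N x" "?N x \<subseteq> verts G" for x
    using irr vts by (auto simp: out_nbhd_def)
  have "step_competes G u v \<longleftrightarrow> (\<exists>w \<in> verts G. w \<noteq> u \<and> w \<noteq> v \<and>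
     (w \<in> ?N u \<and> (w \<in> ?N v \<or> (\<exists>z \<in> ?N v - {u}. w \<in> ?N z)) \<or>
      w \<in> ?N v \<and> (w \<in> ?N u \<or> (\<exists>z \<in> ?N u - {v}. w \<in> ?N z))))"
    unfolding step_competes_def using le by (intro bex_cong refl) (simp cong: conj_cong)
  also have "\<dots> \<longleftrightarrow> (\<exists>a \<in> ?N u - {v}. \<exists>b \<in> ?N v - {u}. a = b \<or> a \<in> ?N b \<or> b \<in> ?N a)"
    (is "?L \<longleftrightarrow> ?R")
  proof
    assume ?L
    then show ?R by blast
  next
    assume ?R
    then obtain a b where ab: "a \<in> ?N u" "a \<noteq> v" "b \<in> ?N v" "b \<noteq> u"
      and "a = b \<or> a \<in> ?N b \<or> b \<in> ?N a"
      by blast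
    moreover have "a \<noteq> u" "b \<noteq> v" "a \<in> verts G" "b \<in> verts G"
      using ab N by blast+
    ultimately show ?L by blast
  qed
  also have "\<dots> \<longleftrightarrow> \<not> noncompeting ?N u v"
    using assms unfolding noncompeting_def by blast
  finally show ?thesis .
qed

section \<open>The complement of the competition graph\<close>

text \<open>The combinatorics needs only the out-neighbourhood map \<open>N\<close>. Fixing one
  non-competing pair in each of \<open>X\<close> and \<open>Y\<close> gives a symmetric setting:
  \<open>swap\<close> exchanges the parts, \<open>relabel\<close> changes the pairs.\<close>

locale two_noncompeting_parts =
  fixes V :: "'a set" and P :: "'a set set" and N :: "'a \<Rightarrow> 'a set"
    and X Y :: "'a set" and x1 x2 y1 y2 :: 'a
  assumes partition: "partition_on V P"
    and N_subset: "u \<in> V \<Longrightarrow> N u \<subseteq> V"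
    and same_part: "Z \<in> P \<Longrightarrow> u \<in> Z \<Longrightarrow> v \<in> Z \<Longrightarrow> v \<notin> N u"
    and diff_parts: "Z \<in> P \<Longrightarrow> Z' \<in> P \<Longrightarrow> Z \<noteq> Z' \<Longrightarrow> u \<in> Z \<Longrightarrow> v \<in> Z' \<Longrightarrow>
      v \<in> N u \<longleftrightarrow> u \<notin> N v"
    and XY: "X \<in> P" "Y \<in> P" "X \<noteq> Y"
    and mem: "x1 \<in> X" "x2 \<in> X" "y1 \<in> Y" "y2 \<in> Y"
    and noncomp: "noncompeting N x1 x2" "noncompeting N y1 y2"
begin

lemma swap: "two_noncompeting_parts V P N Y X y1 y2 x1 x2"
  by unfold_locales
    (fact partition N_subset same_part diff_parts XY XY(3)[symmetric] mem noncomp)+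

lemma relabel:
  assumes "x1' \<in> X" "x2' \<in> X" "y1' \<in> Y" "y2' \<in> Y"
    and "noncompeting N x1' x2'" "noncompeting N y1' y2'"
  shows "two_noncompeting_parts V P N X Y x1' x2' y1' y2'"
  by unfold_locales
    (fact partition N_subset same_part diff_parts XY assms)+

lemma part_exists: "u \<in> V \<Longrightarrow> \<exists>Z \<in> P. u \<in> Z"
  using partition_onD1[OF partition] by blast

lemma part_subset: "Z \<in> P \<Longrightarrow> Z \<subseteq> V"
  using partition_onD1[OF partition] by blast

lemma part_unique: "Z \<in> P \<Longrightarrow> Z' \<in> P \<Longrightarrow> u \<in> Z \<Longrightarrow> u \<in> Z' \<Longrightarrow> Z = Z'"
  using partition_onD2[OF partition] by (auto simp: disjoint_def)

lemma irrefl: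
  assumes "u \<in> V" shows "u \<notin> N u"
  using part_exists[OF assms] same_part by blast

lemma XY_subset: "X \<subseteq> V" "Y \<subseteq> V"
  using part_subset XY by auto

lemma XY_disjoint: "u \<in> X \<Longrightarrow> u \<notin> Y"
  using part_unique XY by blast

lemma arc_iff: "x \<in> X \<Longrightarrow> y \<in> Y \<Longrightarrow> x \<in> N y \<longleftrightarrow> y \<notin> N x"
  using diff_parts XY by blast

lemma noncompeting_disjoint:
  assumes "u \<in> V" "v \<in> V" "noncompeting N u v"
  shows "N u \<inter> N v = {}"
  using assms irrefl unfolding noncompeting_def by blast

lemma noncomp_disjoint: "N x1 \<inter> N x2 = {}" "N y1 \<inter> N y2 = {}"
  using noncompeting_disjoint noncomp mem XY_subset by blast+

text \<open>Elements \<open>a\<close> and \<open>b\<close> of the two reduced out-neighbourhoods are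
  joined by no arc, hence share a part; fixing one and varying the other gives a single part for
  both sets.\<close>

lemma noncompeting_part:
  assumes uv: "u \<in> V" "v \<in> V" "noncompeting N u v"
    and ne: "N u - {v} \<noteq> {}" "N v - {u} \<noteq> {}"
  obtains Z where "Z \<in> P" "N u - {v} \<subseteq> Z" "N v - {u} \<subseteq> Z"
proof -
  have same: "a \<in> Z \<longleftrightarrow> b \<in> Z" if "a \<in> N u - {v}" "b \<in> N v - {u}" "Z \<in> P" for a b Z
  proof -
    have "a \<notin> N b" "b \<notin> N a"
      using uv that unfolding noncompeting_def by blast+
    moreover have "a \<in> V" "b \<in> V"
      using N_subset uv that by blast+
    then obtain A B where "A \<in> P" "a \<in> A" "B \<in> P" "b \<in> B"
      using part_exists by blast
    ultimately show ?thesis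
      using diff_parts part_unique that(3) by metis
  qed
  obtain a where a: "a \<in> N u - {v}" using ne by blast
  obtain b where b: "b \<in> N v - {u}" using ne by blast
  obtain Z where Z: "Z \<in> P" "a \<in> Z"
    using part_exists N_subset uv(1) a by blast
  show thesis
  proof (rule that[OF Z(1)])
    have "b \<in> Z" using same[OF a b Z(1)] Z(2) by simp
    then show "N u - {v} \<subseteq> Z" using same[OF _ b Z(1)] by blast
    show "N v - {u} \<subseteq> Z" using same[OF a _ Z(1)] Z(2) by blast
  qed
qed

text \<open>A sink would be dominated by all vertices of other parts. Its part differs from
  \<open>X\<close> or from \<open>Y\<close>, so it would be a common out-neighbour of
  \<open>x1\<close>, \<open>x2\<close> or of \<open>y1\<close>, \<open>y2\<close>.\<close>

lemma out_nonempty: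
  assumes "s \<in> V" shows "N s \<noteq> {}"
proof
  assume sink: "N s = {}"
  obtain Z where Z: "Z \<in> P" "s \<in> Z"
    using part_exists assms by blast
  have into: "s \<in> N u" if "u \<in> Z'" "Z' \<in> P" "Z' \<noteq> Z" for u Z'
    using diff_parts[OF that(2) Z(1) that(3) that(1) Z(2)] sink by blast
  show False
    using into[of x1 X] into[of x2 X] into[of y1 Y] into[of y2 Y] XY mem
      noncomp_disjoint by blast
qed

section \<open>Location of the non-edges\<close>

text \<open>Both out-neighbourhoods lie in one part. If it were not \<open>Y\<close>, then
  \<open>y1\<close> and \<open>y2\<close> would both dominate \<open>x\<close>, although their
  out-neighbourhoods are disjoint.\<close>

lemma noncompeting_X:
  assumes x: "x \<in> X" "x' \<in> X" "noncompeting N x x'"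
  shows "N x \<subseteq> Y" "N x' \<subseteq> Y"
proof -
  have V: "x \<in> V" "x' \<in> V" using x XY_subset by auto
  have eq: "N x - {x'} = N x" "N x' - {x} = N x'"
    using same_part XY x by blast+
  obtain Z where Z: "Z \<in> P" "N x \<subseteq> Z" "N x' \<subseteq> Z"
    using noncompeting_part[OF V x(3)] eq out_nonempty[OF V(1)] out_nonempty[OF V(2)] by metis
  have "Z = Y"
  proof (rule ccontr)
    assume "Z \<noteq> Y"
    then have "y1 \<notin> N x" "y2 \<notin> N x"
      using Z mem part_unique XY by blast+
    then have "x \<in> N y1" "x \<in> N y2"
      using arc_iff x mem by blast+
    then show False
      using noncomp_disjoint by blast
  qed
  then show "N x \<subseteq> Y" "N x' \<subseteq> Y" using Z by auto
qed

lemma noncompeting_Y: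
  assumes "y \<in> Y" "y' \<in> Y" "noncompeting N y y'"
  shows "N y \<subseteq> X" "N y' \<subseteq> X"
  using two_noncompeting_parts.noncompeting_X[OF swap assms] by auto

lemma noncompeting_XI:
  assumes "x \<in> X" "x' \<in> X" "x \<noteq> x'" "N x \<subseteq> Y" "N x' \<subseteq> Y" "N x \<inter> N x' = {}"
  shows "noncompeting N x x'"
  unfolding noncompeting_def
proof (intro conjI ballI)
  fix a b assume "a \<in> N x - {x'}" "b \<in> N x' - {x}"
  then show "a \<noteq> b" "a \<notin> N b" "b \<notin> N a"
    using assms same_part[OF XY(2)] by blast+
qed fact

lemma noncompeting_YI:
  assumes "y \<in> Y" "y' \<in> Y" "y \<noteq> y'" "N y \<subseteq> X" "N y' \<subseteq> X" "N y \<inter> N y' = {}"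
  shows "noncompeting N y y'"
  unfolding noncompeting_def
proof (intro conjI ballI)
  fix a b assume "a \<in> N y - {y'}" "b \<in> N y' - {y}"
  then show "a \<noteq> b" "a \<notin> N b" "b \<notin> N a"
    using assms same_part[OF XY(1)] by blast+
qed fact

text \<open>The fixed pairs send arcs only into \<open>X \<union> Y\<close>, so a vertex
  \<open>u\<close> outside dominates all four of their members. Then \<open>N u - {v}\<close> meets
  two parts, which forces \<open>N v \<subseteq> {u}\<close>, and \<open>v\<close> is dominated by
  both members of a fixed pair.\<close>

lemma noncompeting_in_XY:
  assumes uv: "u \<in> V" "v \<in> V" "noncompeting N u v"
  shows "u \<in> X \<union> Y"
proof (rule ccontr)
  assume u: "u \<notin> X \<union> Y"
  have into: "x \<in> N u" if "x \<in> X" "N x \<subseteq> Y" for x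
  proof -
    obtain Z where "Z \<in> P" "u \<in> Z" using part_exists uv(1) by blast
    then show ?thesis using diff_parts[of X Z x u] XY u that by blast
  qed
  have into': "y \<in> N u" if "y \<in> Y" "N y \<subseteq> X" for y
  proof -
    obtain Z where "Z \<in> P" "u \<in> Z" using part_exists uv(1) by blast
    then show ?thesis using diff_parts[of Y Z y u] XY u that by blast
  qed
  have Nu: "{x1, x2, y1, y2} \<subseteq> N u"
    using into[of x1] into[of x2] into'[of y1] into'[of y2] noncompeting_X[OF mem(1,2) noncomp(1)]
      noncompeting_Y[OF mem(3,4) noncomp(2)] mem by simp
  have neq: "x1 \<noteq> x2" "y1 \<noteq> y2"
    using noncomp noncompeting_irrefl by metis+
  have "N v - {u} = {}"
  proof (rule ccontr)
    assume "N v - {u} \<noteq> {}"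
    moreover have "N u - {v} \<noteq> {}"
      using Nu neq by blast
    ultimately obtain Z where "Z \<in> P" "N u - {v} \<subseteq> Z"
      using noncompeting_part uv by metis
    then have Z: "Z \<in> P" "{x1, x2, y1, y2} - {v} \<subseteq> Z"
      using Nu by auto
    then have "x1 \<in> Z \<or> x2 \<in> Z" "y1 \<in> Z \<or> y2 \<in> Z"
      using neq by auto
    then have "Z = X" "Z = Y"
      using part_unique Z(1) XY mem by blast+
    then show False
      using XY by simp
  qed
  then have Nv: "N v \<subseteq> {u}" by blast
  obtain Z where Z: "Z \<in> P" "v \<in> Z"
    using part_exists uv(2) by blast
  have into: "v \<in> N w" if "w \<in> Z'" "Z' \<in> P" "Z' \<noteq> Z" "w \<in> X \<union> Y" for w Z'
    using diff_parts[OF that(2) Z(1) that(3) that(1) Z(2)] Nv u that(4) by blast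
  show False
    using into[of x1 X] into[of x2 X] into[of y1 Y] into[of y2 Y] XY mem
      noncomp_disjoint by blast
qed

text \<open>If both reduced out-neighbourhoods are nonempty, they lie in one part other than
  \<open>X\<close> and \<open>Y\<close>. So \<open>Y - {y}\<close> dominates \<open>x\<close> and
  \<open>X - {x}\<close> dominates \<open>y\<close>; the arc between \<open>x\<close> and
  \<open>y\<close> completes one of these to a whole part, giving a fixed pair a common
  out-neighbour.\<close>

lemma noncompeting_XY_iff:
  assumes xy: "x \<in> X" "y \<in> Y"
  shows "noncompeting N x y \<longleftrightarrow> N x = {y} \<or> N y = {x}"
proof
  assume nc: "noncompeting N x y"
  have V: "x \<in> V" "y \<in> V" using xy XY_subset by auto
  show "N x = {y} \<or> N y = {x}"
  proof (rule ccontr)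
    assume "\<not> ?thesis"
    then have ne: "N x - {y} \<noteq> {}" "N y - {x} \<noteq> {}"
      using out_nonempty V by blast+
    then obtain Z where Z: "Z \<in> P" "N x - {y} \<subseteq> Z" "N y - {x} \<subseteq> Z"
      using noncompeting_part[OF V nc] by metis
    have "Z \<noteq> X" "Z \<noteq> Y"
      using ne Z same_part XY xy by blast+
    then have dis: "Z \<inter> X = {}" "Z \<inter> Y = {}"
      using part_unique Z(1) XY by blast+
    have x_into: "x \<in> N y'" if "y' \<in> Y" "y' \<noteq> y" for y'
      using arc_iff[OF xy(1) that(1)] Z(2) dis that by blast
    have y_into: "y \<in> N x'" if "x' \<in> X" "x' \<noteq> x" for x'
      using arc_iff[OF that(1) xy(2)] Z(3) dis that by blast
    show False
    proof (cases "x \<in> N y")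
      case True
      then have "x \<in> N y1" "x \<in> N y2"
        using x_into mem by metis+
      then show False using noncomp_disjoint by blast
    next
      case False
      then have "y \<in> N x1" "y \<in> N x2"
        using y_into mem arc_iff[OF xy] by metis+
      then show False using noncomp_disjoint by blast
    qed
  qed
next
  assume "N x = {y} \<or> N y = {x}"
  moreover have "x \<noteq> y" using XY_disjoint xy by blast
  ultimately show "noncompeting N x y"
    unfolding noncompeting_def by auto
qed

section \<open>Vertices with a single out-neighbour\<close>

text \<open>All vertices of \<open>X\<close> except \<open>x\<close> dominate \<open>y\<close>, so a
  pair avoiding \<open>x\<close> has \<open>y\<close> in common.\<close>

lemma singleton_star:
  assumes "y \<in> Y" "N y = {x}" "x \<in> X" "c \<in> X" "d \<in> X" "noncompeting N c d"
  shows "x = c \<or> x = d"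
proof (rule ccontr)
  assume "\<not> ?thesis"
  then have "y \<in> N c" "y \<in> N d"
    using arc_iff[OF assms(4,1)] arc_iff[OF assms(5,1)] assms(2) by auto
  then show False
    using noncompeting_disjoint assms XY_subset by blast
qed

lemma singleton_star':
  assumes "x \<in> X" "N x = {y}" "y \<in> Y" "c \<in> Y" "d \<in> Y" "noncompeting N c d"
  shows "y = c \<or> y = d"
  using two_noncompeting_parts.singleton_star[OF swap assms] .

text \<open>Dominating neither of \<open>x\<close>, \<open>x'\<close> would make \<open>y\<close>
  their common out-neighbour; dominating both would make \<open>y'\<close> one, since
  \<open>N y'\<close> avoids \<open>N y\<close>.\<close>

lemma exactly_one_dominates:
  assumes "x \<in> X" "x' \<in> X" "noncompeting N x x'" "y \<in> Y" "y' \<in> Y" "noncompeting N y y'"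
  shows "x \<in> N y \<longleftrightarrow> x' \<notin> N y"
proof -
  have "N x \<inter> N x' = {}" "N y \<inter> N y' = {}"
    using noncompeting_disjoint assms XY_subset by blast+
  then show ?thesis
    using arc_iff[of x y] arc_iff[of x y'] arc_iff[of x' y] arc_iff[of x' y'] assms by blast
qed

text \<open>Hence \<open>y\<close> lies in no induced \<open>2K2\<close> of the complement. A pair
  in \<open>X\<close> contains \<open>x\<close>; in a pair in \<open>Y\<close> one end does not
  dominate \<open>x\<close>; in a mixed pair the end in \<open>X\<close> is \<open>x\<close> or is
  the only out-neighbour of the other end.\<close>

lemma singleton_linked:
  assumes y: "y \<in> Y" "N y = {x}" "x \<in> X"
    and cd: "c \<in> V" "d \<in> V" "noncompeting N c d" "y \<noteq> c" "y \<noteq> d"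
  shows "noncompeting N y c \<or> noncompeting N y d"
proof -
  have yx: "noncompeting N y x"
    using noncompeting_XY_iff y noncompeting_sym by metis
  have main: "noncompeting N y c" if "c \<in> Y" "N c \<subseteq> X" "x \<notin> N c" "y \<noteq> c" for c
    using noncompeting_YI y that by auto
  have cross: "noncompeting N y c \<or> noncompeting N y d"
    if "c \<in> X" "d \<in> Y" "noncompeting N c d" "y \<noteq> d" for c d
  proof (cases "c = x")
    case True then show ?thesis using yx by simp
  next
    case False
    then have "y \<in> N c"
      using arc_iff y that by auto
    then have "N d = {c}"
      using noncompeting_XY_iff that by blast
    then show ?thesis using main[of d] that False by auto
  qed
  consider "c \<in> X" "d \<in> X" | "c \<in> Y" "d \<in> Y" | "c \<in> X" "d \<in> Y" | "c \<in> Y" "d \<in> X"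
    using noncompeting_in_XY cd noncompeting_sym by (metis UnE)
  then show ?thesis
  proof cases
    case 1
    then show ?thesis using singleton_star[OF y] cd yx by blast
  next
    case 2
    then have "x \<notin> N c \<or> x \<notin> N d"
      using noncompeting_disjoint cd by blast
    then show ?thesis using main noncompeting_Y[OF 2 cd(3)] 2 cd by blast
  next
    case 3 then show ?thesis using cross cd by blast
  next
    case 4 then show ?thesis using cross[of d c] cd noncompeting_sym by metis
  qed
qed

section \<open>Excluding two unlinked non-edges\<close>

definition no_2K2 :: bool where
  "no_2K2 \<longleftrightarrow> (\<forall>a \<in> V. \<forall>b \<in> V. \<forall>c \<in> V. \<forall>d \<in> V.
     noncompeting N a b \<longrightarrow> noncompeting N c d \<longrightarrow> distinct [a, b, c, d] \<longrightarrow>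
     noncompeting N a c \<or> noncompeting N a d \<or> noncompeting N b c \<or> noncompeting N b d)"

lemma no_2K2_if_card:
  assumes fin: "finite V" and card: "card X \<le> 3"
  shows no_2K2
proof -
  interpret swap: two_noncompeting_parts V P N Y X y1 y2 x1 x2 by (rule swap)
  \<comment> \<open>\<open>s\<close> marks the vertices to which \<open>singleton_linked\<close>
    applies, directly or after swapping \<open>X\<close> and \<open>Y\<close>.\<close>
  define s where "s u \<longleftrightarrow> (u \<in> Y \<and> (\<exists>x \<in> X. N u = {x})) \<or> (u \<in> X \<and> (\<exists>y \<in> Y. N u = {y}))" for u
  have s: "noncompeting N u c \<or> noncompeting N u d"
    if "s u" "c \<in> V" "d \<in> V" "noncompeting N c d" "u \<noteq> c" "u \<noteq> d" for u c d
    using that singleton_linked swap.singleton_linked unfolding s_def by metis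
  have sY: "s u \<or> s v" if uv: "u \<in> Y" "v \<in> Y" "noncompeting N u v" for u v
  proof -
    have sub: "N u \<subseteq> X" "N v \<subseteq> X" using noncompeting_Y uv by auto
    have V: "u \<in> V" "v \<in> V" using uv XY_subset by auto
    have finX: "finite X" using fin XY_subset finite_subset by blast
    then have finN: "finite (N u)" "finite (N v)" using sub finite_subset by blast+
    have "card (N u) + card (N v) = card (N u \<union> N v)"
      using card_Un_disjoint[OF finN noncompeting_disjoint[OF V uv(3)]] by simp
    also have "\<dots> \<le> 3"
      using card_mono[OF finX, of "N u \<union> N v"] sub card by auto
    finally have "card (N u) + card (N v) \<le> 3" .
    moreover have "card (N u) \<noteq> 0" "card (N v) \<noteq> 0"
      using finN out_nonempty V by auto
    ultimately have "card (N u) = 1 \<or> card (N v) = 1"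
      by linarith
    then show ?thesis
      using sub uv unfolding s_def by (auto simp: card_1_singleton_iff)
  qed
  have sXY: "s u \<or> s v" if uv: "u \<in> X" "v \<in> Y" "noncompeting N u v" for u v
    using that noncompeting_XY_iff unfolding s_def by blast
  have edge: "s u \<or> s v \<or> u \<in> X \<and> v \<in> X" if "u \<in> V" "v \<in> V" "noncompeting N u v" for u v
    using that noncompeting_in_XY sY sXY noncompeting_sym by (metis UnE)
  \<comment> \<open>All non-edges inside \<open>X\<close> share \<open>x\<close>, so two disjoint
    ones cannot both lie in \<open>X\<close>, and some end is marked by \<open>s\<close>.\<close>
  obtain x where x: "\<And>u v. u \<in> X \<Longrightarrow> v \<in> X \<Longrightarrow> noncompeting N u v \<Longrightarrow> x = u \<or> x = v"
  proof -
    obtain y x where "y \<in> Y" "x \<in> X" "N y = {x}"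
      using sY[OF mem(3,4) noncomp(2)] mem XY_disjoint unfolding s_def by blast
    then show thesis using that singleton_star by blast
  qed
  show ?thesis
    unfolding no_2K2_def
  proof (intro ballI impI)
    fix a b c d
    assume V: "a \<in> V" "b \<in> V" "c \<in> V" "d \<in> V"
      and nc: "noncompeting N a b" "noncompeting N c d" and dist: "distinct [a, b, c, d]"
    have "s a \<or> s b \<or> s c \<or> s d"
      using edge[OF V(1,2) nc(1)] edge[OF V(3,4) nc(2)] x[OF _ _ nc(1)] x[OF _ _ nc(2)] dist by auto
    moreover have "a \<noteq> c" "a \<noteq> d" "b \<noteq> c" "b \<noteq> d"
      using dist by auto
    ultimately show "noncompeting N a c \<or> noncompeting N a d \<or> noncompeting N b c \<or> noncompeting N b d"
      using s[of a c d] s[of b c d] s[of c a b] s[of d a b] V nc noncompeting_sym[of N]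
      by metis
  qed
qed

section \<open>Transitive orientation of the complement\<close>

text \<open>Each of the classes \<open>A\<close>, \<open>B\<close>, \<open>L\<close> and
  \<open>{x2}\<close> is free of non-edges, so a ranking of the four orients every non-edge. Where
  \<open>x2\<close> is ranked depends on whether it has a non-edge to \<open>B\<close>.\<close>

lemma transitive_orientation_if_singleton:
  assumes single: "N y1 = {x2}"
  obtains R where "\<And>u. \<not> R u u" "\<And>u v w. R u v \<Longrightarrow> R v w \<Longrightarrow> R u w"
    "\<And>u v. u \<in> V \<Longrightarrow> v \<in> V \<Longrightarrow> noncompeting N u v \<longleftrightarrow> R u v \<or> R v u"
proof -
  define A where "A = {y \<in> Y. x2 \<in> N y}"
  define B where "B = {y \<in> Y. x2 \<notin> N y}"
  define L where "L = X - {x2}"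
  let ?H = "noncompeting N"
  have y1A: "y1 \<in> A" using single mem by (auto simp: A_def)
  have y2B: "y2 \<in> B"
    using single noncomp_disjoint mem by (auto simp: B_def)
  have disj: "x2 \<notin> A" "x2 \<notin> B" "x2 \<notin> L" "A \<inter> B = {}" "A \<inter> L = {}" "B \<inter> L = {}"
    using XY_disjoint mem by (auto simp: A_def B_def L_def)
  \<comment> \<open>Since \<open>a\<close> dominates \<open>x2\<close>, the singleton must be
    \<open>N l\<close>; its element is \<open>y1\<close> or \<open>y2\<close> by
    \<open>singleton_star'\<close>, and \<open>y2\<close> is in \<open>B\<close>.\<close>
  have AL: "a = y1 \<and> N l = {y1}" if "a \<in> A" "l \<in> L" "?H a l" for a l
  proof -
    have "N l = {a}"
      using noncompeting_XY_iff[of l a] noncompeting_sym[of N l a] that by (auto simp: A_def L_def)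
    moreover from this have "a = y1 \<or> a = y2"
      using singleton_star'[of l a y1 y2] that mem noncomp by (auto simp: A_def L_def)
    ultimately show ?thesis
      using that(1) y2B disj by auto
  qed
  \<comment> \<open>\<open>N l = {y1}\<close> excludes \<open>N l = {b}\<close>, so
    \<open>N b = {l}\<close>, which is disjoint from \<open>N y1 = {x2}\<close>.\<close>
  have ALB: "?H a b" if "a \<in> A" "l \<in> L" "b \<in> B" "?H a l" "?H l b" for a l b
  proof -
    have a: "a = y1" "N l = {y1}" using AL that by blast+
    then have "N b = {l}"
      using noncompeting_XY_iff[of l b] that y1A disj by (auto simp: L_def B_def)
    then show ?thesis
      using noncompeting_YI[of y1 b] a that single mem y1A disj by (auto simp: L_def B_def)
  qed
  have y1x2: "?H y1 x2"
    using noncompeting_XY_iff[of x2 y1] mem single noncompeting_sym by metis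
  have classes: "u \<in> A \<or> u \<in> L \<or> u = x2 \<or> u \<in> B" if "u \<in> V" "v \<in> V" "?H u v" for u v
    using noncompeting_in_XY[OF that] by (auto simp: A_def B_def L_def)
  have nLL: "\<not> ?H u v" if "u \<in> L" "v \<in> L" for u v
    using singleton_star[OF mem(3) single mem(2), of u v] that by (auto simp: L_def)
  have Yone: "x2 \<in> N u \<longleftrightarrow> x2 \<notin> N v" if "u \<in> Y" "v \<in> Y" "?H u v" for u v
    using two_noncompeting_parts.exactly_one_dominates[OF swap that mem(2,1)] noncomp
      arc_iff mem that noncompeting_sym by metis
  have nAA: "\<not> ?H u v" if "u \<in> A" "v \<in> A" for u v
    using Yone[of u v] that by (auto simp: A_def)
  have nBB: "\<not> ?H u v" if "u \<in> B" "v \<in> B" for u v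
    using Yone[of u v] that by (auto simp: B_def)
  show thesis
  proof (cases "\<exists>b \<in> B. ?H x2 b")
    case False
    \<comment> \<open>The last value also falls to vertices outside all four classes, which have no
      non-edges.\<close>
    define rk :: "'a \<Rightarrow> nat" where
      "rk u = (if u \<in> A then 0 else if u \<in> L then 1 else if u = x2 then 2 else 3)" for u
    define R where "R u v \<longleftrightarrow> u \<in> V \<and> v \<in> V \<and> ?H u v \<and> rk u < rk v" for u v
    show thesis
    proof (rule that[of R])
      show "\<not> R u u" for u by (simp add: R_def)
      show "R u w" if uv: "R u v" and vw: "R v w" for u v w
      proof -
        have H: "?H u v" "?H v w" and rk: "rk u < rk v" "rk v < rk w" and V: "u \<in> V" "v \<in> V" "w \<in> V"
          using uv vw by (auto simp: R_def)
        have cls: "v \<in> A \<or> v \<in> L \<or> v = x2 \<or> v \<in> B" "w \<in> A \<or> w \<in> L \<or> w = x2 \<or> w \<in> B"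
          using classes[OF V(2,3) H(2)] classes[OF V(3,2)] H(2) noncompeting_sym by metis+
        \<comment> \<open>Only \<open>B\<close> ranks above \<open>x2\<close>, and there is no
          non-edge between them here, so a chain of three starts in \<open>A\<close> and has its
          middle in \<open>L\<close>.\<close>
        have "v \<noteq> x2"
          using False H(2) cls(2) rk(2) disj by (auto simp: rk_def split: if_splits)
        then have "u \<in> A" "v \<in> L" "w = x2 \<or> w \<in> B"
          using rk cls disj by (auto simp: rk_def split: if_splits)
        then have "?H u w"
          using ALB[of u v w] AL[of u v] H y1x2 by blast
        then show ?thesis using V rk by (simp add: R_def)
      qed
      show "?H u v \<longleftrightarrow> R u v \<or> R v u" if "u \<in> V" "v \<in> V" for u v
      proof -
        have "rk u \<noteq> rk v" if H: "?H u v"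
          using classes[OF \<open>u \<in> V\<close> \<open>v \<in> V\<close> H] classes[OF \<open>v \<in> V\<close> \<open>u \<in> V\<close>] noncompeting_sym[of N u v] H
            nLL[of u v] nAA[of u v] nBB[of u v] noncompeting_irrefl[of N u] disj
          by (auto simp: rk_def split: if_splits)
        then show ?thesis
          using that noncompeting_sym[of N u v] by (auto simp: R_def)
      qed
    qed
  next
    case True
    then obtain b where "b \<in> B" "?H x2 b" by blast
    \<comment> \<open>\<open>b\<close> does not dominate \<open>x2\<close>, so the singleton is
      \<open>N x2\<close>; as \<open>x2\<close> dominates all of \<open>B\<close>, this class
      shrinks to \<open>{y2}\<close>.\<close>
    then have "N x2 = {b}"
      using noncompeting_XY_iff[of x2 b] mem by (auto simp: B_def)
    moreover have "B \<subseteq> N x2"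
      using arc_iff mem by (auto simp: B_def)
    ultimately have x2: "N x2 = {y2}" and B: "B = {y2}"
      using y2B \<open>b \<in> B\<close> by auto
    have x2y2: "?H x2 y2"
      using noncompeting_XY_iff x2 mem by blast
    \<comment> \<open>With \<open>x2\<close> ranked first, its non-edge to \<open>y2\<close>, the
      only member of \<open>B\<close>, closes every chain from \<open>x2\<close> to
      \<open>B\<close>.\<close>
    define rk :: "'a \<Rightarrow> nat" where
      "rk u = (if u = x2 then 0 else if u \<in> A then 1 else if u \<in> L then 2 else 3)" for u
    define R where "R u v \<longleftrightarrow> u \<in> V \<and> v \<in> V \<and> ?H u v \<and> rk u < rk v" for u v
    show thesis
    proof (rule that[of R])
      show "\<not> R u u" for u by (simp add: R_def)
      show "R u w" if uv: "R u v" and vw: "R v w" for u v w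
      proof -
        have H: "?H u v" "?H v w" and rk: "rk u < rk v" "rk v < rk w" and V: "u \<in> V" "v \<in> V" "w \<in> V"
          using uv vw by (auto simp: R_def)
        have cls: "v \<in> A \<or> v \<in> L \<or> v = x2 \<or> v \<in> B" "w \<in> A \<or> w \<in> L \<or> w = x2 \<or> w \<in> B"
          using classes[OF V(2,3) H(2)] classes[OF V(3,2)] H(2) noncompeting_sym by metis+
        have x2L: "?H x2 l" if "a \<in> A" "l \<in> L" "?H a l" for a l
          using noncompeting_XI[of x2 l] AL[OF that] x2 that mem y1A y2B disj by (auto simp: L_def)
        consider "u = x2" "v \<in> A" "w \<in> L" | "u = x2" "w \<in> B" | "u \<in> A" "v \<in> L" "w \<in> B"
          using rk cls disj by (auto simp: rk_def split: if_splits)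
        then have "?H u w"
          using x2L x2y2 B ALB H by cases blast+
        then show ?thesis using V rk by (simp add: R_def)
      qed
      show "?H u v \<longleftrightarrow> R u v \<or> R v u" if "u \<in> V" "v \<in> V" for u v
      proof -
        have "rk u \<noteq> rk v" if H: "?H u v"
          using classes[OF \<open>u \<in> V\<close> \<open>v \<in> V\<close> H] classes[OF \<open>v \<in> V\<close> \<open>u \<in> V\<close>] noncompeting_sym[of N u v] H
            nLL[of u v] nAA[of u v] nBB[of u v] noncompeting_irrefl[of N u] disj
          by (auto simp: rk_def split: if_splits)
        then show ?thesis
          using that noncompeting_sym[of N u v] by (auto simp: R_def)
      qed
    qed
  qed
qed

text \<open>Applied to the two fixed pairs, the absence of \<open>2K2\<close> yields a non-edge
  between them, hence a singleton out-neighbourhood; relabelling, and swapping the parts if needed,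
  brings it to the form \<open>N y1 = {x2}\<close>.\<close>

lemma transitive_orientation:
  assumes no_2K2
  obtains R where "\<And>u. \<not> R u u" "\<And>u v w. R u v \<Longrightarrow> R v w \<Longrightarrow> R u w"
    "\<And>u v. u \<in> V \<Longrightarrow> v \<in> V \<Longrightarrow> noncompeting N u v \<longleftrightarrow> R u v \<or> R v u"
proof -
  have "x1 \<noteq> x2" "y1 \<noteq> y2"
    using noncomp noncompeting_irrefl by metis+
  then have "distinct [x1, x2, y1, y2]"
    using mem XY_disjoint by auto
  then have "noncompeting N x1 y1 \<or> noncompeting N x1 y2 \<or> noncompeting N x2 y1 \<or> noncompeting N x2 y2"
    using assms noncomp mem XY_subset unfolding no_2K2_def by blast
  then obtain x x' y y' where *: "x \<in> X" "x' \<in> X" "noncompeting N x x'"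
    "y \<in> Y" "y' \<in> Y" "noncompeting N y y'" "noncompeting N x y"
    using noncomp mem noncompeting_sym by metis
  then consider "N x = {y}" | "N y = {x}"
    using noncompeting_XY_iff by blast
  then show thesis
  proof cases
    case 1
    interpret r: two_noncompeting_parts V P N X Y x x' y' y
      using relabel * noncompeting_sym by metis
    show thesis
      using two_noncompeting_parts.transitive_orientation_if_singleton[OF r.swap 1] that by metis
  next
    case 2
    interpret r: two_noncompeting_parts V P N X Y x' x y y'
      using relabel * noncompeting_sym by metis
    show thesis
      using r.transitive_orientation_if_singleton[OF 2] that by metis
  qed
qed

end

section \<open>Return to the competition graph\<close>

theorem theorem4p9:
  fixes D :: "('a, 'b) pre_digraph" and P :: "'a set set"
  assumes "multipartite_tournament D P"
    and "card {X \<in> P. \<not> step_competing D X} = 2"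
  shows "(interval_graph (step_competition_graph D) \<longleftrightarrow> chordal (step_competition_graph D)) \<and>
    (chordal (step_competition_graph D) \<longleftrightarrow>
       \<not> (\<exists>vs. induced_cycle (step_competition_graph D) vs \<and> length vs = 4)) \<and>
    ((\<exists>X \<in> P. \<forall>Y \<in> P - {X}. card Y \<le> 3) \<longrightarrow> interval_graph (step_competition_graph D))"
proof -
  interpret digraph D
    using assms(1) by (simp add: multipartite_tournament_def)
  let ?G = "step_competition_graph D"
  let ?H = "noncompeting (out_nbhd D)"
  have pv: "pverts ?G = verts D"
    by (simp add: step_competition_graph_def)
  have arcs: "(u, v) \<in> parcs ?G \<longleftrightarrow> u \<noteq> v \<and> \<not> ?H u v" if "u \<in> verts D" "v \<in> verts D" for u v
    using that by (auto simp: step_competition_graph_def step_competes_iff)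
  have part: "partition_on (verts D) P"
    using assms(1) by (simp add: multipartite_tournament_def)
  obtain X Y where XY: "{X \<in> P. \<not> step_competing D X} = {X, Y}" "X \<noteq> Y"
    using assms(2) by (auto simp: card_2_iff)
  have witness: "\<exists>u \<in> Z. \<exists>v \<in> Z. ?H u v" if "Z \<in> {X, Y}" for Z
  proof -
    have "Z \<in> P" "\<not> step_competing D Z" using that XY by blast+
    moreover from this have "Z \<subseteq> verts D" using partition_onD1[OF part] by blast
    ultimately show ?thesis
      using arcs unfolding step_competing_def is_clique_def pv by blast
  qed
  obtain x1 x2 where x: "x1 \<in> X" "x2 \<in> X" "?H x1 x2" using witness by blast
  obtain y1 y2 where y: "y1 \<in> Y" "y2 \<in> Y" "?H y1 y2" using witness by blast
  interpret T: two_noncompeting_parts "verts D" P "out_nbhd D" X Y x1 x2 y1 y2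
  proof
    show "out_nbhd D u \<subseteq> verts D" for u
      by (auto simp: out_nbhd_def arcs_ends_def arc_to_ends_def)
    show "v \<notin> out_nbhd D u" if "Z \<in> P" "u \<in> Z" "v \<in> Z" for Z u v
      using assms(1) that by (fastforce simp: multipartite_tournament_def out_nbhd_def)
    show "v \<in> out_nbhd D u \<longleftrightarrow> u \<notin> out_nbhd D v"
      if "Z \<in> P" "Z' \<in> P" "Z \<noteq> Z'" "u \<in> Z" "v \<in> Z'" for Z Z' u v
      using assms(1) that unfolding multipartite_tournament_def out_nbhd_def by simp metis
    show "X \<in> P" "Y \<in> P" using XY by blast+
  qed (fact part XY(2) x y)+
  have interval: "interval_graph ?G" if free: T.no_2K2
  proof -
    obtain R where R: "\<And>u. \<not> R u u" "\<And>u v w. R u v \<Longrightarrow> R v w \<Longrightarrow> R u w"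
      "\<And>u v. u \<in> verts D \<Longrightarrow> v \<in> verts D \<Longrightarrow> ?H u v \<longleftrightarrow> R u v \<or> R v u"
      using T.transitive_orientation[OF free] by metis
    show ?thesis
    proof (rule interval_graph_if_transitive_orientation[of _ R])
      fix a b c d
      assume V: "{a, b, c, d} \<subseteq> pverts ?G" and ab: "R a b" and cd: "R c d"
      show "R a d \<or> R c b"
      proof (cases "distinct [a, b, c, d]")
        case True
        then have "?H a c \<or> ?H a d \<or> ?H b c \<or> ?H b d"
          using free V ab cd R(3) unfolding T.no_2K2_def pv by auto
        \<comment> \<open>A relation between \<open>{a, b}\<close> and \<open>{c, d}\<close>, in
          either direction, extends by transitivity to one of the two required ones.\<close>
        then show ?thesis
          using R(2,3) V ab cd unfolding pv by (metis insert_subset)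
      next
        case False
        then show ?thesis using R(1,2) ab cd by auto
      qed
    qed (use R arcs pv in auto)
  qed
  have free_if_no_C4: T.no_2K2 if noC4: "\<not> (\<exists>vs. induced_cycle ?G vs \<and> length vs = 4)"
    unfolding T.no_2K2_def
  proof (intro ballI impI, rule ccontr)
    fix a b c d
    assume V: "a \<in> verts D" "b \<in> verts D" "c \<in> verts D" "d \<in> verts D"
      and H: "?H a b" "?H c d" "distinct [a, b, c, d]"
        "\<not> (?H a c \<or> ?H a d \<or> ?H b c \<or> ?H b d)"
    \<comment> \<open>The two non-edges become the diagonals of the cycle.\<close>
    have "induced_cycle ?G [a, c, b, d]"
      using V H noncompeting_sym[of "out_nbhd D"]
      unfolding induced_cycle_def pv by (auto simp: arcs less_Suc_eq)
    then show False using noC4 by fastforce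
  qed
  have "interval_graph ?G \<Longrightarrow> chordal ?G"
    by (rule interval_graph_imp_chordal)
  moreover have "chordal ?G \<Longrightarrow> \<not> (\<exists>vs. induced_cycle ?G vs \<and> length vs = 4)"
    unfolding chordal_def by auto
  moreover have "interval_graph ?G" if "\<not> (\<exists>vs. induced_cycle ?G vs \<and> length vs = 4)"
    using interval free_if_no_C4 that by blast
  moreover have "interval_graph ?G" if "\<exists>X \<in> P. \<forall>Y \<in> P - {X}. card Y \<le> 3"
  proof -
    have "card X \<le> 3 \<or> card Y \<le> 3"
      using that T.XY by blast
    then have T.no_2K2
    proof
      assume "card X \<le> 3"
      then show ?thesis by (intro T.no_2K2_if_card) auto
    next
      assume "card Y \<le> 3"
      interpret S: two_noncompeting_parts "verts D" P "out_nbhd D" Y X y1 y2 x1 x2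
        by (rule T.swap)
      have S.no_2K2 using \<open>card Y \<le> 3\<close> by (intro S.no_2K2_if_card) auto
      \<comment> \<open>\<open>no_2K2\<close> mentions only the vertices and their
        out-neighbourhoods, so the swap leaves it unchanged.\<close>
      then show ?thesis unfolding S.no_2K2_def T.no_2K2_def .
    qed
    then show ?thesis by (rule interval)
  qed
  ultimately show ?thesis by blast
qed

end
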